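(* The cochain $h_{(0)}h_{(1)}h_{(2)}c_{(0)}c_{(2)}\in\mathrm{D}^\infty\mathrm{W}_1$ is closed and represents a non-trivial class in $F_{0,5}$, the $0$-eigenspace of $\delta\circ\sigma$ on the order-$5$ part of $H^*(\mathrm{D}^\infty\mathrm{W}_1)$.
   Context: Let $\widetilde{\mathrm{D}^\infty\mathrm{W}}_1=\bigwedge[h_{(i)}]_{i\ge0}\otimes\mathbb{R}[c_{(j)}]_{j\ge0}$, with $h_{(i)}$ odd of degree 1, $c_{(j)}$ even of degree 2, and differential (signed derivation) $dh_{(i)}=c_{(i)}$, $dc_{(i)}=0$. The order is the additive grading with $\mathrm{ord}(h_{(i)})=\mathrm{ord}(c_{(i)})=i$. Let $\widetilde\delta,\widetilde\sigma$ be the unsigned derivations with $\widetilde\delta(c_{(i)})=c_{(i+1)}$, $\widetilde\delta(h_{(i)})=h_{(i+1)}$, $\widetilde\sigma(c_{(i)})=\frac12i(i-1)c_{(i-1)}$, $\widetilde\sigma(h_{(i)})=\frac12i(i-1)h_{(i-1)}$ (zero for $i=0$). Set $\mathrm{D}^\infty\mathrm{W}_1=\widetilde{\mathrm{D}^\infty\mathrm{W}}_1/\mathscr{I}$, where $\mathscr{I}$ is the ideal generated by $\widetilde\delta^k(c_{(0)}^2)$, $k\ge0$. The derivations $\widetilde\delta,\widetilde\sigma$ preserve $\mathscr{I}$ and commute with $d$; they induce derivations $\delta,\sigma$ of $H^*(\mathrm{D}^\infty\mathrm{W}_1)$. *)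

theory Defs
  imports Complex_Main "HOL-Library.FSet" "HOL-Library.Multiset"
begin

section \<open>The free graded-commutative algebra\<close>

text \<open>
  A monomial \<open>(A, m)\<close> stands for the exterior product of the \<open>h\<^sub>(\<^sub>a\<^sub>)\<close>, \<open>a \<in> A\<close>, taken in
  increasing order of the indices, times the product of the \<open>c\<^sub>(\<^sub>j\<^sub>)\<close>, \<open>j\<close> ranging over the
  multiset \<open>m\<close>.
\<close>

type_synonym monomial = "nat fset \<times> nat multiset"

typedef wtilde = "{f :: monomial \<Rightarrow> real. finite {p. f p \<noteq> 0}}"
  morphisms coeff Abs_wtilde
  by (rule exI[of _ "\<lambda>_. 0"]) simp

setup_lifting type_definition_wtilde

lemma wtilde_eqI: "(\<And>p. coeff x p = coeff y p) \<Longrightarrow> x = y"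
  by transfer (rule ext, simp)

instantiation wtilde :: real_vector
begin

lift_definition zero_wtilde :: wtilde is "\<lambda>_. 0" by simp

lift_definition plus_wtilde :: "wtilde \<Rightarrow> wtilde \<Rightarrow> wtilde" is "\<lambda>f g p. f p + g p"
  subgoal for f g
    by (rule finite_subset[of _ "{p. f p \<noteq> 0} \<union> {p. g p \<noteq> 0}"]) auto
  done

lift_definition minus_wtilde :: "wtilde \<Rightarrow> wtilde \<Rightarrow> wtilde" is "\<lambda>f g p. f p - g p"
  subgoal for f g
    by (rule finite_subset[of _ "{p. f p \<noteq> 0} \<union> {p. g p \<noteq> 0}"]) auto
  done

lift_definition uminus_wtilde :: "wtilde \<Rightarrow> wtilde" is "\<lambda>f p. - f p" by simp

lift_definition scaleR_wtilde :: "real \<Rightarrow> wtilde \<Rightarrow> wtilde" is "\<lambda>r f p. r * f p"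
  subgoal for r f
    by (rule finite_subset[of _ "{p. f p \<noteq> 0}"]) auto
  done

instance
  by standard (transfer; simp add: algebra_simps)+

end

lift_definition basis_elt :: "monomial \<Rightarrow> wtilde" is "\<lambda>p q. if q = p then 1 else 0"
  by simp

definition supp :: "wtilde \<Rightarrow> monomial set" where
  "supp x = {p. coeff x p \<noteq> 0}"

definition lin_ext :: "(monomial \<Rightarrow> 'a) \<Rightarrow> wtilde \<Rightarrow> 'a::real_vector" where
  "lin_ext F x = (\<Sum>p\<in>supp x. coeff x p *\<^sub>R F p)"

lemma coeff_simps [simp]:
  "coeff 0 p = 0" "coeff (x + y) p = coeff x p + coeff y p" "coeff (x - y) p = coeff x p - coeff y p"
  "coeff (- x) p = - coeff x p" "coeff (r *\<^sub>R x) p = r * coeff x p"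
  "coeff (basis_elt q) p = (if p = q then 1 else 0)"
  by (transfer; simp)+

lemma finite_supp [simp]: "finite (supp x)"
  unfolding supp_def by transfer

lemma lin_ext_superset:
  assumes "finite S" "supp x \<subseteq> S"
  shows "lin_ext F x = (\<Sum>p\<in>S. coeff x p *\<^sub>R F p)"
  unfolding lin_ext_def using assms by (intro sum.mono_neutral_left) (auto simp: supp_def)

lemma linear_lin_ext: "linear (lin_ext F)"
proof (rule linearI)
  fix x y
  let ?S = "supp x \<union> supp y"
  have "supp (x + y) \<subseteq> ?S" by (auto simp: supp_def)
  then show "lin_ext F (x + y) = lin_ext F x + lin_ext F y"
    by (simp add: lin_ext_superset[of ?S] scaleR_add_left sum.distrib)
next
  fix r x
  have "supp (r *\<^sub>R x) \<subseteq> supp x" by (auto simp: supp_def)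
  then show "lin_ext F (r *\<^sub>R x) = r *\<^sub>R lin_ext F x"
    by (simp add: lin_ext_superset[of "supp x"] scaleR_sum_right)
qed

lemma lin_ext_basis [simp]: "lin_ext F (basis_elt p) = F p"
proof -
  have "supp (basis_elt p) = {p}" by (auto simp: supp_def)
  then show ?thesis by (simp add: lin_ext_def)
qed

lemma coeff_sum: "coeff (sum f S) p = (\<Sum>i\<in>S. coeff (f i) p)"
  by (induction S rule: infinite_finite_induct) auto

lemma lin_ext_expand: "lin_ext basis_elt x = x"
proof (rule wtilde_eqI)
  fix p
  have "coeff (lin_ext basis_elt x) p = (\<Sum>q\<in>supp x. if p = q then coeff x q else 0)"
    unfolding lin_ext_def by (simp add: coeff_sum if_distrib cong: if_cong)
  also have "\<dots> = (if p \<in> supp x then coeff x p else 0)"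
    by (rule sum.delta'[OF finite_supp])
  finally show "coeff (lin_ext basis_elt x) p = coeff x p"
    by (simp add: supp_def split: if_splits)
qed

lemma linear_eq_on_basis:
  assumes "linear f" "linear g" "\<And>p. f (basis_elt p) = g (basis_elt p)"
  shows "f x = g x"
proof -
  have "f (lin_ext basis_elt x) = g (lin_ext basis_elt x)"
    unfolding lin_ext_def using assms by (simp add: linear_sum linear_cmul)
  then show ?thesis by (simp add: lin_ext_expand)
qed

text \<open>
  The sign produced by sorting the concatenation of \<open>A\<close> and \<open>B\<close>; it is \<open>0\<close> if \<open>A\<close> and \<open>B\<close>
  have an index in common.
\<close>

definition shuffle_sign :: "nat set \<Rightarrow> nat set \<Rightarrow> real" where
  "shuffle_sign A B = (\<Prod>a\<in>A. \<Prod>b\<in>B. sgn (real b - real a))"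

definition mono_mult :: "monomial \<Rightarrow> monomial \<Rightarrow> wtilde" where
  "mono_mult p q =
     shuffle_sign (fset (fst p)) (fset (fst q)) *\<^sub>R basis_elt (fst p |\<union>| fst q, snd p + snd q)"

lemma sign_eq_0:
  assumes "finite A" "finite B" "A \<inter> B \<noteq> {}"
  shows "shuffle_sign A B = 0"
proof -
  obtain a where a: "a \<in> A" "a \<in> B" using assms by auto
  have "(\<Prod>b\<in>B. sgn (real b - real a)) = 0"
    by (rule prod_zero) (use assms a in \<open>auto intro: bexI[of _ a]\<close>)
  then show ?thesis unfolding shuffle_sign_def
    by (intro prod_zero bexI[of _ a]) (use assms a in auto)
qed

lemma sign_union_left:
  "finite A \<Longrightarrow> finite B \<Longrightarrow> A \<inter> B = {} \<Longrightarrow>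
    shuffle_sign (A \<union> B) C = shuffle_sign A C * shuffle_sign B C"
  unfolding shuffle_sign_def by (rule prod.union_disjoint)

lemma sign_union_right:
  "finite B \<Longrightarrow> finite C \<Longrightarrow> B \<inter> C = {} \<Longrightarrow>
    shuffle_sign A (B \<union> C) = shuffle_sign A B * shuffle_sign A C"
  unfolding shuffle_sign_def by (simp add: prod.union_disjoint prod.distrib)

lemma sign_empty [simp]: "shuffle_sign {} B = 1" "shuffle_sign A {} = 1"
  by (simp_all add: shuffle_sign_def)

lemma sign_assoc:
  assumes "finite A" "finite B" "finite C"
  shows "shuffle_sign A B * shuffle_sign (A \<union> B) C = shuffle_sign B C * shuffle_sign A (B \<union> C)"
proof (cases "A \<inter> B = {} \<and> B \<inter> C = {}")
  case True
  then show ?thesis using assms by (simp add: sign_union_left sign_union_right)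
next
  case False
  then have "A \<inter> B \<noteq> {} \<and> A \<inter> (B \<union> C) \<noteq> {} \<or> B \<inter> C \<noteq> {} \<and> (A \<union> B) \<inter> C \<noteq> {}" by auto
  then show ?thesis
  proof
    assume "A \<inter> B \<noteq> {} \<and> A \<inter> (B \<union> C) \<noteq> {}"
    then have "shuffle_sign A B = 0" "shuffle_sign A (B \<union> C) = 0"
      using assms by (blast intro: sign_eq_0 finite_UnI)+
    then show ?thesis by simp
  next
    assume "B \<inter> C \<noteq> {} \<and> (A \<union> B) \<inter> C \<noteq> {}"
    then have "shuffle_sign B C = 0" "shuffle_sign (A \<union> B) C = 0"
      using assms by (blast intro: sign_eq_0 finite_UnI)+
    then show ?thesis by simp
  qed
qed

lemma sign_square:
  assumes "A \<inter> B = {}"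
  shows "shuffle_sign A B * shuffle_sign A B = 1"
proof -
  have "shuffle_sign A B * shuffle_sign A B =
      (\<Prod>a\<in>A. \<Prod>b\<in>B. sgn (real b - real a) * sgn (real b - real a))"
    unfolding shuffle_sign_def prod.distrib ..
  also have "\<dots> = (\<Prod>a\<in>A. \<Prod>b\<in>B. 1)"
    by (intro prod.cong refl) (use assms in \<open>auto simp: sgn_if\<close>)
  finally show ?thesis by simp
qed

lemma sign_swap: "shuffle_sign B A = (-1) ^ (card A * card B) * shuffle_sign A B"
proof -
  have s: "sgn (real a - real b) = (-1) * sgn (real b - real a)" for a b
    by (simp add: sgn_if)
  have "shuffle_sign B A = (\<Prod>b\<in>B. \<Prod>a\<in>A. (-1) * sgn (real b - real a))"
    unfolding shuffle_sign_def by (subst s) simp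
  also have "\<dots> = (\<Prod>a\<in>A. \<Prod>b\<in>B. (-1) * sgn (real b - real a))" 
    by (rule prod.swap)
  also have "\<dots> = (-1) ^ (card A * card B) * shuffle_sign A B"
    unfolding shuffle_sign_def prod.distrib by (simp add: power_mult[symmetric] mult.commute)
  finally show ?thesis .
qed

instantiation wtilde :: real_algebra_1
begin

definition one_wtilde :: wtilde where
  "1 = basis_elt ({||}, {#})"

definition times_wtilde :: "wtilde \<Rightarrow> wtilde \<Rightarrow> wtilde" where
  "x * y = lin_ext (\<lambda>p. lin_ext (\<lambda>q. mono_mult p q) y) x"

lemma linear_times_left: "linear (\<lambda>x::wtilde. x * y)"
  unfolding times_wtilde_def by (rule linear_lin_ext)

lemma linear_times_right: "linear (\<lambda>y::wtilde. x * y)"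
proof -
  note l = linear_lin_ext[of "mono_mult _"]
  show ?thesis
    unfolding times_wtilde_def lin_ext_def[of _ x]
    by (rule linearI)
       (simp_all add: linear_add[OF l] linear_cmul[OF l] scaleR_add_right sum.distrib
         scaleR_sum_right mult.commute)
qed

lemma basis_times: "basis_elt p * basis_elt q = mono_mult p q"
  by (simp add: times_wtilde_def)

lemma times_assoc_basis: "basis_elt p * basis_elt q * basis_elt r = basis_elt p * (basis_elt q * basis_elt r)"
proof -
  obtain A l B m C n where p: "p = (A, l)" "q = (B, m)" "r = (C, n)"
    by (metis surj_pair)
  have "shuffle_sign (fset A) (fset B) * shuffle_sign (fset A \<union> fset B) (fset C) =
        shuffle_sign (fset B) (fset C) * shuffle_sign (fset A) (fset B \<union> fset C)"
    by (rule sign_assoc) auto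
  then show ?thesis
    by (simp add: p basis_times mono_mult_def linear_cmul[OF linear_times_left]
        linear_cmul[OF linear_times_right] ac_simps)
qed

instance
proof
  fix x y z :: wtilde and r :: real
  show "(x + y) * z = x * z + y * z" by (rule linear_add[OF linear_times_left])
  show "x * (y + z) = x * y + x * z" by (rule linear_add[OF linear_times_right])
  show "r *\<^sub>R x * y = r *\<^sub>R (x * y)" by (rule linear_cmul[OF linear_times_left])
  show "x * r *\<^sub>R y = r *\<^sub>R (x * y)" by (rule linear_cmul[OF linear_times_right])
  have L: "linear (\<lambda>x. x * y * z)" "linear (\<lambda>x. y * x * z)" "linear (\<lambda>x. y * (x * z))" "linear (\<lambda>x. y * (z * x))"
    for y z :: wtilde
    using linear_compose[OF linear_times_left[of y] linear_times_left[of z]]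
      linear_compose[OF linear_times_right[of y] linear_times_left[of z]]
      linear_compose[OF linear_times_left[of z] linear_times_right[of y]]
      linear_compose[OF linear_times_right[of z] linear_times_right[of y]]
    by (simp_all add: comp_def)
  have "x * basis_elt q * basis_elt r = x * (basis_elt q * basis_elt r)" for q r
    by (rule linear_eq_on_basis[OF L(1) linear_times_left times_assoc_basis])
  then have "x * y * basis_elt r = x * (y * basis_elt r)" for r
    by (rule linear_eq_on_basis[OF L(2) L(3)])
  then show "x * y * z = x * (y * z)"
    by (rule linear_eq_on_basis[OF linear_times_right L(4)])
  show "1 * x = x"
    by (rule linear_eq_on_basis[OF linear_times_right linear_ident])
       (simp add: one_wtilde_def basis_times mono_mult_def)
  show "x * 1 = x"
    by (rule linear_eq_on_basis[OF linear_times_left linear_ident])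
       (simp add: one_wtilde_def basis_times mono_mult_def)
  have "coeff (0::wtilde) ({||}, {#}) \<noteq> coeff 1 ({||}, {#})" by (simp add: one_wtilde_def)
  then show "(0::wtilde) \<noteq> 1" by metis
qed

end

definition hT :: "nat \<Rightarrow> wtilde" where
  "hT i = basis_elt ({|i|}, {#})"

definition cT :: "nat \<Rightarrow> wtilde" where
  "cT i = basis_elt ({||}, {#i#})"

definition mono_deg :: "monomial \<Rightarrow> nat" where
  "mono_deg p = fcard (fst p) + 2 * size (snd p)"

definition mono_ord :: "monomial \<Rightarrow> nat" where
  "mono_ord p = \<Sum> (fset (fst p)) + \<Sum>\<^sub># (snd p)"

definition ord_part_T :: "nat \<Rightarrow> wtilde set" where
  "ord_part_T n = {x. \<forall>p. coeff x p \<noteq> 0 \<longrightarrow> mono_ord p = n}"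

text \<open>The parity involution \<open>x \<mapsto> (-1)\<^sup>|\<^sup>x\<^sup>| x\<close>.\<close>

definition parity :: "wtilde \<Rightarrow> wtilde" where
  "parity = lin_ext (\<lambda>p. (-1) ^ mono_deg p *\<^sub>R basis_elt p)"

definition signed_derivation :: "(wtilde \<Rightarrow> wtilde) \<Rightarrow> bool" where
  "signed_derivation D \<longleftrightarrow> linear D \<and> (\<forall>x y. D (x * y) = D x * y + parity x * D y)"

definition unsigned_derivation :: "('a::real_algebra_1 \<Rightarrow> 'a) \<Rightarrow> bool" where
  "unsigned_derivation D \<longleftrightarrow> linear D \<and> (\<forall>x y. D (x * y) = D x * y + x * D y)"

text \<open>
  The partial derivatives: \<open>diff_h a\<close> moves \<open>h\<^sub>(\<^sub>a\<^sub>)\<close> to the front and removes it, \<open>diff_c j\<close> is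
  the usual partial derivative with respect to \<open>c\<^sub>(\<^sub>j\<^sub>)\<close>.
\<close>

definition diff_h :: "nat \<Rightarrow> wtilde \<Rightarrow> wtilde" where
  "diff_h a = lin_ext (\<lambda>p. if a |\<in>| fst p
     then shuffle_sign {a} (fset (fst p) - {a}) *\<^sub>R basis_elt (fst p |-| {|a|}, snd p) else 0)"

definition diff_c :: "nat \<Rightarrow> wtilde \<Rightarrow> wtilde" where
  "diff_c j = lin_ext (\<lambda>p. real (count (snd p) j) *\<^sub>R basis_elt (fst p, snd p - {#j#}))"

text \<open>
  The derivation with values \<open>H i\<close> on \<open>h\<^sub>(\<^sub>i\<^sub>)\<close> and \<open>C i\<close> on \<open>c\<^sub>(\<^sub>i\<^sub>)\<close>. Since the new factor is
  put at the front, the same formula gives an unsigned derivation if all \<open>H i\<close> are odd and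
  all \<open>C i\<close> are even, and a signed derivation if all \<open>H i\<close> are even and all \<open>C i\<close> vanish.
\<close>

definition der :: "(nat \<Rightarrow> wtilde) \<Rightarrow> (nat \<Rightarrow> wtilde) \<Rightarrow> wtilde \<Rightarrow> wtilde" where
  "der H C = lin_ext (\<lambda>p. (\<Sum>a\<in>fset (fst p). H a * diff_h a (basis_elt p)) +
     (\<Sum>j\<in>set_mset (snd p). C j * diff_c j (basis_elt p)))"

definition dT :: "wtilde \<Rightarrow> wtilde" where
  "dT = der cT (\<lambda>_. 0)"

definition deltaT :: "wtilde \<Rightarrow> wtilde" where
  "deltaT = der (\<lambda>i. hT (i + 1)) (\<lambda>i. cT (i + 1))"

text \<open>For \<open>i = 0\<close> the coefficient vanishes, so the truncated index \<open>i - 1\<close> is irrelevant.\<close>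

definition sigmaT :: "wtilde \<Rightarrow> wtilde" where
  "sigmaT = der (\<lambda>i. (real i * (real i - 1) / 2) *\<^sub>R hT (i - 1))
               (\<lambda>i. (real i * (real i - 1) / 2) *\<^sub>R cT (i - 1))"


subsection \<open>Basic properties\<close>

lemma basis_induct [case_names basis add scale]:
  assumes "\<And>p. P (basis_elt p)" "\<And>x y. P x \<Longrightarrow> P y \<Longrightarrow> P (x + y)" "\<And>r x. P x \<Longrightarrow> P (r *\<^sub>R x)"
  shows "P x"
proof -
  have 0: "P 0" using assms(3)[OF assms(1), of 0] by simp
  have "P (\<Sum>p\<in>S. coeff x p *\<^sub>R basis_elt p)" if "finite S" for S
    using that by induction (auto intro: assms 0)
  then show ?thesis
    using lin_ext_expand[of x] by (metis finite_supp lin_ext_def)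
qed

lemma basis_c: "basis_elt (A, add_mset j m) = cT j * basis_elt (A, m)"
  by (simp add: cT_def basis_times mono_mult_def)

lemma basis_h:
  assumes "a |\<notin>| A"
  shows "basis_elt (finsert a A, m) = shuffle_sign {a} (fset A) *\<^sub>R (hT a * basis_elt (A, m))"
  using sign_square[of "{a}" "fset A"] assms
  by (simp add: hT_def basis_times mono_mult_def)

lemma wtilde_induct [case_names one h c add scale times]:
  assumes "P 1" "\<And>i. P (hT i)" "\<And>i. P (cT i)"
    and "\<And>x y. P x \<Longrightarrow> P y \<Longrightarrow> P (x + y)" "\<And>r x. P x \<Longrightarrow> P (r *\<^sub>R x)"
    and "\<And>x y. P x \<Longrightarrow> P y \<Longrightarrow> P (x * y)"
  shows "P x"
proof (induction x rule: basis_induct)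
  case (basis p)
  obtain A m where p: "p = (A, m)" by force
  have "P (basis_elt ({||}, m))"
    by (induction m) (auto simp: basis_c assms simp flip: one_wtilde_def)
  then have "P (basis_elt (A, m))"
    by (induction A) (auto simp: basis_h assms)
  then show ?case by (simp add: p)
qed (auto intro: assms)

lemma linear_parity: "linear parity"
  unfolding parity_def by (rule linear_lin_ext)

lemma linear_diff_h: "linear (diff_h a)"
  unfolding diff_h_def by (rule linear_lin_ext)

lemma linear_diff_c: "linear (diff_c a)"
  unfolding diff_c_def by (rule linear_lin_ext)

lemma linear_der: "linear (der H C)"
  unfolding der_def by (rule linear_lin_ext)

lemmas parity_simps [simp] = linear_add[OF linear_parity] linear_diff[OF linear_parity]
  linear_cmul[OF linear_parity] linear_0[OF linear_parity] linear_neg[OF linear_parity]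
lemmas diff_h_simps [simp] = linear_add[OF linear_diff_h] linear_diff[OF linear_diff_h]
  linear_cmul[OF linear_diff_h] linear_0[OF linear_diff_h] linear_neg[OF linear_diff_h]
lemmas diff_c_simps [simp] = linear_add[OF linear_diff_c] linear_diff[OF linear_diff_c]
  linear_cmul[OF linear_diff_c] linear_0[OF linear_diff_c] linear_neg[OF linear_diff_c]
lemmas der_simps [simp] = linear_add[OF linear_der] linear_diff[OF linear_der]
  linear_cmul[OF linear_der] linear_0[OF linear_der] linear_neg[OF linear_der]

lemma parity_basis [simp]: "parity (basis_elt p) = (-1) ^ mono_deg p *\<^sub>R basis_elt p"
  by (simp add: parity_def)

lemma parity_gen [simp]: "parity 1 = 1" "parity (hT i) = - hT i" "parity (cT i) = cT i"
  by (simp_all add: one_wtilde_def hT_def cT_def mono_deg_def fcard.rep_eq)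

lemma parity_parity [simp]: "parity (parity x) = x"
  by (induction x rule: basis_induct) (simp_all add: power_mult_distrib[symmetric])

lemma mono_mult_deg:
  "(-1) ^ mono_deg p * (-1) ^ mono_deg q * shuffle_sign (fset (fst p)) (fset (fst q)) =
    (-1) ^ mono_deg (fst p |\<union>| fst q, snd p + snd q) * shuffle_sign (fset (fst p)) (fset (fst q))"
proof (cases "fset (fst p) \<inter> fset (fst q) = {}")
  case True
  then have "fcard (fst p |\<union>| fst q) = fcard (fst p) + fcard (fst q)"
    by (simp add: fcard.rep_eq card_Un_disjoint)
  then show ?thesis by (simp add: mono_deg_def power_add algebra_simps)
qed (simp add: sign_eq_0)

lemma parity_basis_times:
  "parity (basis_elt p * basis_elt q) = parity (basis_elt p) * parity (basis_elt q)"
proof -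
  let ?s = "shuffle_sign (fset (fst p)) (fset (fst q))"
  let ?r = "basis_elt (fst p |\<union>| fst q, snd p + snd q)"
  have "parity (basis_elt p * basis_elt q) =
      ((-1) ^ mono_deg (fst p |\<union>| fst q, snd p + snd q) * ?s) *\<^sub>R ?r"
    by (simp add: basis_times mono_mult_def mult.commute)
  also have "\<dots> = ((-1) ^ mono_deg p * (-1) ^ mono_deg q * ?s) *\<^sub>R ?r"
    by (simp only: mono_mult_deg)
  also have "\<dots> = parity (basis_elt p) * parity (basis_elt q)"
    by (simp add: basis_times mono_mult_def)
  finally show ?thesis .
qed

lemma parity_times [simp]: "parity (x * y) = parity x * parity y"
proof (induction x rule: basis_induct)
  case (basis p)
  show ?case
    by (induction y rule: basis_induct)
       (simp_all only: parity_basis_times ring_distribs parity_simps mult_scaleR_right)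
qed (simp_all only: ring_distribs parity_simps mult_scaleR_left)

lemma times_h: "x * hT a = hT a * parity x"
proof (induction x rule: basis_induct)
  case (basis p)
  have "shuffle_sign (fset (fst p)) {a} = (-1) ^ fcard (fst p) * shuffle_sign {a} (fset (fst p))"
    using sign_swap[of "fset (fst p)" "{a}"] by (simp add: fcard.rep_eq)
  then show ?case
    by (simp add: hT_def basis_times mono_mult_def mono_deg_def power_add power_mult)
qed (simp_all add: algebra_simps)

lemma times_c: "x * cT a = cT a * x"
  by (induction x rule: basis_induct)
     (simp_all add: cT_def basis_times mono_mult_def algebra_simps)

lemma diff_h_basis: "diff_h a (basis_elt (A, m)) = (if a |\<in>| A
     then shuffle_sign {a} (fset A - {a}) *\<^sub>R basis_elt (A |-| {|a|}, m) else 0)"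
  by (simp add: diff_h_def)

lemma basis_times': "basis_elt (A, m) * basis_elt (B, n) =
    shuffle_sign (fset A) (fset B) *\<^sub>R basis_elt (A |\<union>| B, m + n)"
  by (simp add: basis_times mono_mult_def)

lemma sign_remove_left:
  assumes "finite A" "a \<in> A"
  shows "shuffle_sign A B = shuffle_sign {a} B * shuffle_sign (A - {a}) B"
  using sign_union_left[of "{a}" "A - {a}" B] assms by (simp add: insert_absorb)

lemma sign_remove_right:
  assumes "finite B" "a \<in> B"
  shows "shuffle_sign A B = shuffle_sign A {a} * shuffle_sign A (B - {a})"
  using sign_union_right[of "{a}" "B - {a}" A] assms by (simp add: insert_absorb)

lemma diff_h_basis_times:
  "diff_h a (basis_elt p * basis_elt q) =
     diff_h a (basis_elt p) * basis_elt q + parity (basis_elt p) * diff_h a (basis_elt q)"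
proof -
  obtain A m B n where pq: "p = (A, m)" "q = (B, n)" by force
  let ?A = "fset A" and ?B = "fset B" and ?A' = "fset A - {a}" and ?B' = "fset B - {a}"
  let ?s = shuffle_sign
  have par: "parity (basis_elt (A, m)) = (-1) ^ card ?A *\<^sub>R basis_elt (A, m)"
    by (simp add: mono_deg_def fcard.rep_eq power_add power_mult)
  have swap: "?s X {a} = (-1) ^ card X * ?s {a} X" for X
    using sign_swap[of X "{a}"] by simp
  consider (left) "a |\<in>| A" "?A \<inter> ?B = {}" | (right) "a |\<in>| B" "?A \<inter> ?B = {}"
    | (none) "a |\<notin>| A" "a |\<notin>| B" | (other) b where "b \<in> ?A" "b \<in> ?B" "b \<noteq> a"
    | (both) "a |\<in>| A" "a |\<in>| B" "?A' \<inter> ?B' = {}"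
  proof (cases "?A' \<inter> ?B' = {}")
    case True
    then show thesis
      by (cases "a |\<in>| A"; cases "a |\<in>| B") (auto intro: that(1-3,5))
  next
    case False
    then obtain b where "b \<in> ?A" "b \<in> ?B" "b \<noteq> a" by auto
    then show thesis by (rule that(4))
  qed
  then have "diff_h a (basis_elt (A, m) * basis_elt (B, n)) =
     diff_h a (basis_elt (A, m)) * basis_elt (B, n) +
     parity (basis_elt (A, m)) * diff_h a (basis_elt (B, n))"
  proof cases
    case left
    then have B: "a |\<notin>| B" by auto
    then have e: "A |\<union>| B |-| {|a|} = (A |-| {|a|}) |\<union>| B" "?A \<union> ?B - {a} = ?A' \<union> ?B" by auto
    have "?s {a} (?A' \<union> ?B) = ?s {a} ?A' * ?s {a} ?B"
      using left by (intro sign_union_right) auto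
    then have "?s ?A ?B * ?s {a} (?A' \<union> ?B) =
        (?s {a} ?B * ?s {a} ?B) * (?s {a} ?A' * ?s ?A' ?B)"
      using sign_remove_left[of ?A a ?B] left by simp
    then have "?s ?A ?B * ?s {a} (?A' \<union> ?B) = ?s {a} ?A' * ?s ?A' ?B"
      using sign_square[of "{a}" ?B] B by simp
    then show ?thesis
      using left B by (simp add: basis_times' diff_h_basis e)
  next
    case right
    then have A: "a |\<notin>| A" by auto
    then have e: "A |\<union>| B |-| {|a|} = A |\<union>| (B |-| {|a|})" "?A \<union> ?B - {a} = ?A \<union> ?B'" by auto
    have "?s {a} (?A \<union> ?B') = ?s {a} ?A * ?s {a} ?B'"
      using right by (intro sign_union_right) auto
    then have "?s ?A ?B * ?s {a} (?A \<union> ?B') =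
        (?s {a} ?A * ?s {a} ?A) * ((-1) ^ card ?A * ?s ?A ?B' * ?s {a} ?B')"
      using sign_remove_right[of ?B a ?A] right by (simp add: swap)
    then have "?s ?A ?B * ?s {a} (?A \<union> ?B') = (-1) ^ card ?A * ?s ?A ?B' * ?s {a} ?B'"
      using sign_square[of "{a}" ?A] A by simp
    then have "?s ?A ?B * ?s {a} (?A \<union> ?B') = (-1) ^ card ?A * (?s {a} ?B' * ?s ?A ?B')"
      by (simp only: ac_simps)
    then show ?thesis
      using right A unfolding par by (simp add: basis_times' diff_h_basis e)
  next
    case none
    then show ?thesis by (simp add: basis_times' diff_h_basis)
  next
    case other
    then have "?s ?A ?B = 0" "?s ?A' ?B = 0" "?s ?A ?B' = 0"
      by (intro sign_eq_0; auto)+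
    then show ?thesis unfolding par by (simp add: basis_times' diff_h_basis)
  next
    case both
    have AB: "?s ?A ?B = 0"
      using both by (intro sign_eq_0) auto
    have e: "A |\<union>| (B |-| {|a|}) = A |\<union>| B" "(A |-| {|a|}) |\<union>| B = A |\<union>| B"
      using both by auto
    have c: "(-1::real) ^ card ?A = - ((-1) ^ card ?A')"
      using both card_Suc_Diff1[of ?A a] by (metis finite_fset power_Suc mult_minus1)
    have "?s {a} ?A' * ?s ?A' ?B + (-1) ^ card ?A * ?s {a} ?B' * ?s ?A ?B' =
        ?s {a} ?A' * (((-1) ^ card ?A' * ?s {a} ?A') * ?s ?A' ?B') +
        - ((-1) ^ card ?A') * ?s {a} ?B' * (?s {a} ?B' * ?s ?A' ?B')"
      using both by (simp only: sign_remove_left[of ?A a ?B'] sign_remove_right[of ?B a ?A']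
          finite_fset c swap[of ?A'])
    also have "\<dots> = (?s {a} ?A' * ?s {a} ?A') * ((-1) ^ card ?A' * ?s ?A' ?B') -
        (?s {a} ?B' * ?s {a} ?B') * ((-1) ^ card ?A' * ?s ?A' ?B')"
      by (simp add: ac_simps)
    also have "\<dots> = 0"
      using sign_square[of "{a}" ?A'] sign_square[of "{a}" ?B'] by simp
    finally have z: "?s {a} ?A' * ?s ?A' ?B + (-1) ^ card ?A * ?s {a} ?B' * ?s ?A ?B' = 0" .
    have "diff_h a (basis_elt (A, m)) * basis_elt (B, n) +
        parity (basis_elt (A, m)) * diff_h a (basis_elt (B, n)) =
        (?s {a} ?A' * ?s ?A' ?B + (-1) ^ card ?A * ?s {a} ?B' * ?s ?A ?B') *\<^sub>R
          basis_elt (A |\<union>| B, m + n)"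
      using both unfolding par
      by (simp add: basis_times' diff_h_basis e scaleR_add_left mult.assoc)
    then show ?thesis
      using AB by (simp add: z basis_times' del: parity_basis)
  qed
  then show ?thesis by (simp only: pq)
qed

lemma diff_c_basis:
  "diff_c a (basis_elt (A, m)) = real (count m a) *\<^sub>R basis_elt (A, m - {#a#})"
  by (simp add: diff_c_def)

lemma diff_c_basis_times:
  "diff_c a (basis_elt p * basis_elt q) =
     diff_c a (basis_elt p) * basis_elt q + basis_elt p * diff_c a (basis_elt q)"
proof -
  obtain A m B n where pq: "p = (A, m)" "q = (B, n)" by force
  have m: "real (count m a) *\<^sub>R basis_elt (A |\<union>| B, m - {#a#} + n) =
      real (count m a) *\<^sub>R basis_elt (A |\<union>| B, m + n - {#a#})"
    by (cases "a \<in># m") (simp_all add: not_in_iff)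
  have n: "real (count n a) *\<^sub>R basis_elt (A |\<union>| B, m + (n - {#a#})) =
      real (count n a) *\<^sub>R basis_elt (A |\<union>| B, m + n - {#a#})"
    by (cases "a \<in># n") (simp_all add: not_in_iff)
  let ?s = "shuffle_sign (fset A) (fset B)"
  have "diff_c a (basis_elt p) * basis_elt q + basis_elt p * diff_c a (basis_elt q) =
      ?s *\<^sub>R (real (count m a) *\<^sub>R basis_elt (A |\<union>| B, m - {#a#} + n)) +
      ?s *\<^sub>R (real (count n a) *\<^sub>R basis_elt (A |\<union>| B, m + (n - {#a#})))"
    by (simp add: pq basis_times' diff_c_basis mult.commute)
  also have "\<dots> = diff_c a (basis_elt p * basis_elt q)"
    unfolding m n by (simp add: pq basis_times' diff_c_basis scaleR_add_left scaleR_add_right)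
  finally show ?thesis by simp
qed

lemma diff_h_times: "diff_h a (x * y) = diff_h a x * y + parity x * diff_h a y"
proof (induction x rule: basis_induct)
  case (basis p)
  show ?case
    by (induction y rule: basis_induct)
       (simp_all only: diff_h_basis_times ring_distribs diff_h_simps mult_scaleR_right 
          scaleR_add_right ac_simps)
qed (simp_all only: ring_distribs parity_simps diff_h_simps mult_scaleR_left scaleR_add_right ac_simps)

lemma diff_c_times: "diff_c a (x * y) = diff_c a x * y + x * diff_c a y"
proof (induction x rule: basis_induct)
  case (basis p)
  show ?case
    by (induction y rule: basis_induct)
       (simp_all only: diff_c_basis_times ring_distribs diff_c_simps mult_scaleR_right 
          scaleR_add_right ac_simps)
qed (simp_all only: ring_distribs diff_c_simps mult_scaleR_left scaleR_add_right ac_simps)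

lemma eventually_der:
  "\<forall>\<^sub>F N in sequentially. der H C x = (\<Sum>a<N. H a * diff_h a x + C a * diff_c a x)"
proof (induction x rule: basis_induct)
  case (basis p)
  have "\<forall>\<^sub>F N in sequentially. \<forall>a\<in>fset (fst p). a < N"
    "\<forall>\<^sub>F N in sequentially. \<forall>a\<in>set_mset (snd p). a < N"
    by (simp_all add: eventually_ball_finite_distrib eventually_gt_at_top)
  then show ?case
  proof eventually_elim
    case (elim N)
    have "(\<Sum>a\<in>fset (fst p). H a * diff_h a (basis_elt p)) = (\<Sum>a<N. H a * diff_h a (basis_elt p))"
      using elim by (intro sum.mono_neutral_left) (auto simp: diff_h_def)
    moreover have "(\<Sum>a\<in>set_mset (snd p). C a * diff_c a (basis_elt p)) =
        (\<Sum>a<N. C a * diff_c a (basis_elt p))"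
      using elim by (intro sum.mono_neutral_left) (auto simp: diff_c_def not_in_iff)
    ultimately show ?case by (simp add: der_def sum.distrib)
  qed
next
  case (add x y)
  then show ?case
    by eventually_elim (simp add: algebra_simps sum.distrib)
next
  case (scale r x)
  then show ?case
    by eventually_elim (simp add: scaleR_sum_right scaleR_add_right)
qed

lemma der_expand3:
  obtains N where
    "der H C x = (\<Sum>a<N. H a * diff_h a x + C a * diff_c a x)"
    "der H C y = (\<Sum>a<N. H a * diff_h a y + C a * diff_c a y)"
    "der H C z = (\<Sum>a<N. H a * diff_h a z + C a * diff_c a z)"
proof -
  have "\<forall>\<^sub>F N in sequentially.
     der H C x = (\<Sum>a<N. H a * diff_h a x + C a * diff_c a x) \<and>
     der H C y = (\<Sum>a<N. H a * diff_h a y + C a * diff_c a y) \<and>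
     der H C z = (\<Sum>a<N. H a * diff_h a z + C a * diff_c a z)"
    by (intro eventually_conj eventually_der)
  then show ?thesis using that by (auto simp: eventually_sequentially)
qed

lemma unsigned_derivation_der:
  assumes "\<And>a x. x * H a = H a * parity x" "\<And>a x. x * C a = C a * x"
  shows "unsigned_derivation (der H C)"
  unfolding unsigned_derivation_def
proof (intro conjI allI linear_der)
  fix x y
  obtain N where N:
    "der H C x = (\<Sum>a<N. H a * diff_h a x + C a * diff_c a x)"
    "der H C y = (\<Sum>a<N. H a * diff_h a y + C a * diff_c a y)"
    "der H C (x * y) = (\<Sum>a<N. H a * diff_h a (x * y) + C a * diff_c a (x * y))"
    by (rule der_expand3)
  have "H a * diff_h a (x * y) + C a * diff_c a (x * y) =
     (H a * diff_h a x + C a * diff_c a x) * y + x * (H a * diff_h a y + C a * diff_c a y)" for a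
    by (simp add: diff_h_times diff_c_times ring_distribs assms flip: mult.assoc)
  then have "(\<Sum>a<N. H a * diff_h a (x * y) + C a * diff_c a (x * y)) =
     (\<Sum>a<N. H a * diff_h a x + C a * diff_c a x) * y +
     x * (\<Sum>a<N. H a * diff_h a y + C a * diff_c a y)"
    by (simp only: sum.distrib[symmetric] sum_distrib_left sum_distrib_right)
  then show "der H C (x * y) = der H C x * y + x * der H C y"
    unfolding N .
qed

lemma signed_derivation_der:
  assumes "\<And>a x. x * H a = H a * x"
  shows "signed_derivation (der H (\<lambda>_. 0))"
  unfolding signed_derivation_def
proof (intro conjI allI linear_der)
  fix x y
  let ?C = "\<lambda>_. 0"
  obtain N where N:
    "der H ?C x = (\<Sum>a<N. H a * diff_h a x + 0 * diff_c a x)"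
    "der H ?C y = (\<Sum>a<N. H a * diff_h a y + 0 * diff_c a y)"
    "der H ?C (x * y) = (\<Sum>a<N. H a * diff_h a (x * y) + 0 * diff_c a (x * y))"
    by (rule der_expand3)
  have "H a * diff_h a (x * y) = (H a * diff_h a x) * y + parity x * (H a * diff_h a y)" for a
    by (simp add: diff_h_times ring_distribs assms flip: mult.assoc)
  then show "der H ?C (x * y) = der H ?C x * y + parity x * der H ?C y"
    unfolding N by (simp add: sum.distrib sum_distrib_left sum_distrib_right)
qed

lemma der_h [simp]: "der H C (hT i) = H i"
  by (simp add: der_def hT_def diff_h_def one_wtilde_def[symmetric])

lemma der_c [simp]: "der H C (cT i) = C i"
  by (simp add: der_def cT_def diff_c_def one_wtilde_def[symmetric])

lemma signed_derivation_dT: "signed_derivation dT"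
  unfolding dT_def by (rule signed_derivation_der) (rule times_c)

lemma unsigned_derivation_deltaT: "unsigned_derivation deltaT"
  unfolding deltaT_def by (rule unsigned_derivation_der) (rule times_h times_c)+

lemma unsigned_derivation_sigmaT: "unsigned_derivation sigmaT"
  unfolding sigmaT_def by (rule unsigned_derivation_der) (simp_all add: times_h times_c)

lemma dT_gen [simp]: "dT (hT i) = cT i" "dT (cT i) = 0"
  by (simp_all add: dT_def)

lemma deltaT_gen [simp]: "deltaT (hT i) = hT (i + 1)" "deltaT (cT i) = cT (i + 1)"
  by (simp_all add: deltaT_def)

lemma sigmaT_gen:
  "sigmaT (hT i) = (real i * (real i - 1) / 2) *\<^sub>R hT (i - 1)"
  "sigmaT (cT i) = (real i * (real i - 1) / 2) *\<^sub>R cT (i - 1)"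
  by (simp_all add: sigmaT_def)

lemma dT_times: "dT (x * y) = dT x * y + parity x * dT y"
  and deltaT_times: "deltaT (x * y) = deltaT x * y + x * deltaT y"
  and sigmaT_times: "sigmaT (x * y) = sigmaT x * y + x * sigmaT y"
  using signed_derivation_dT unsigned_derivation_deltaT unsigned_derivation_sigmaT
  by (simp_all add: signed_derivation_def unsigned_derivation_def)

lemma linear_T: "linear dT" "linear deltaT" "linear sigmaT"
  by (simp_all only: dT_def deltaT_def sigmaT_def linear_der)

lemmas T_simps [simp] =
  linear_T[THEN linear_add] linear_T[THEN linear_diff] linear_T[THEN linear_cmul]
  linear_T[THEN linear_0] linear_T[THEN linear_neg]

lemma T_one [simp]: "dT 1 = 0" "deltaT 1 = 0" "sigmaT 1 = 0"
  using dT_times[of 1 1] deltaT_times[of 1 1] sigmaT_times[of 1 1] by simp_all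

lemma parity_deltaT: "parity (deltaT x) = deltaT (parity x)"
  by (induction x rule: wtilde_induct) (simp_all add: deltaT_times)

lemma parity_sigmaT: "parity (sigmaT x) = sigmaT (parity x)"
  by (induction x rule: wtilde_induct) (simp_all add: sigmaT_times sigmaT_gen)

lemma parity_dT: "parity (dT x) = - dT (parity x)"
  by (induction x rule: wtilde_induct) (simp_all add: dT_times)

lemma dT_dT: "dT (dT x) = 0"
  by (induction x rule: wtilde_induct) (simp_all add: dT_times parity_dT)

lemma deltaT_dT: "deltaT (dT x) = dT (deltaT x)"
  by (induction x rule: wtilde_induct)
     (simp_all add: dT_times deltaT_times parity_deltaT algebra_simps)

lemma sigmaT_dT: "sigmaT (dT x) = dT (sigmaT x)"
  by (induction x rule: wtilde_induct)
     (simp_all add: dT_times sigmaT_times sigmaT_gen parity_sigmaT algebra_simps)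

text \<open>The derivation that multiplies by the order.\<close>

definition eulerT :: "wtilde \<Rightarrow> wtilde" where
  "eulerT = der (\<lambda>i. real i *\<^sub>R hT i) (\<lambda>i. real i *\<^sub>R cT i)"

lemma eulerT_times: "eulerT (x * y) = eulerT x * y + x * eulerT y"
proof -
  have "unsigned_derivation eulerT"
    unfolding eulerT_def by (rule unsigned_derivation_der) (simp_all add: times_h times_c)
  then show ?thesis by (simp add: unsigned_derivation_def)
qed

lemma eulerT_gen: "eulerT (hT i) = real i *\<^sub>R hT i" "eulerT (cT i) = real i *\<^sub>R cT i"
  by (simp_all add: eulerT_def)

lemma linear_eulerT: "linear eulerT"
  by (simp only: eulerT_def linear_der)

lemmas eulerT_simps [simp] =
  linear_eulerT[THEN linear_add] linear_eulerT[THEN linear_cmul] linear_eulerT[THEN linear_0]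

lemma eulerT_one [simp]: "eulerT 1 = 0"
  using eulerT_times[of 1 1] by simp

lemma eulerT_deltaT: "eulerT (deltaT x) = deltaT (eulerT x) + deltaT x"
  by (induction x rule: wtilde_induct)
     (simp_all add: eulerT_times deltaT_times eulerT_gen algebra_simps)

lemma sigmaT_deltaT: "sigmaT (deltaT x) = deltaT (sigmaT x) + eulerT x"
proof -
  have *: "(real (i + 1) * (real (i + 1) - 1) / 2) *\<^sub>R v =
      (real i * (real i - 1) / 2) *\<^sub>R v + real i *\<^sub>R v" for i and v :: wtilde
    by (simp add: field_simps flip: scaleR_add_left)
  have **: "(real i * (real i - 1) / 2) *\<^sub>R f (i - 1 + 1) = (real i * (real i - 1) / 2) *\<^sub>R f i"
    for i and f :: "nat \<Rightarrow> wtilde"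
    by (cases i) simp_all
  show ?thesis
  proof (induction x rule: wtilde_induct)
    case (h i)
    show ?case
      by (simp only: sigmaT_gen deltaT_gen eulerT_gen T_simps * ** add_diff_cancel_right')
  next
    case (c i)
    show ?case
      by (simp only: sigmaT_gen deltaT_gen eulerT_gen T_simps * ** add_diff_cancel_right')
  qed (simp_all add: eulerT_times deltaT_times sigmaT_times algebra_simps)
qed


section \<open>The quotient\<close>

definition two_sided_ideal :: "'a::ring_1 set \<Rightarrow> bool" where
  "two_sided_ideal I \<longleftrightarrow> 0 \<in> I \<and> (\<forall>x\<in>I. \<forall>y\<in>I. x + y \<in> I) \<and> (\<forall>a. \<forall>x\<in>I. a * x \<in> I \<and> x * a \<in> I)"

definition relI :: "wtilde set" where
  "relI = two_sided_ideal hull {(deltaT ^^ k) (cT 0 ^ 2) |k. True}"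

lemma ideal_relI: "two_sided_ideal relI"
  unfolding relI_def by (rule hull_in) (auto simp: two_sided_ideal_def)

lemma relI_gen: "(deltaT ^^ k) (cT 0 ^ 2) \<in> relI"
  unfolding relI_def by (rule hull_inc) auto

lemma relI_0: "0 \<in> relI"
  and relI_add: "x \<in> relI \<Longrightarrow> y \<in> relI \<Longrightarrow> x + y \<in> relI"
  and relI_left: "x \<in> relI \<Longrightarrow> a * x \<in> relI"
  and relI_right: "x \<in> relI \<Longrightarrow> x * a \<in> relI"
  using ideal_relI by (auto simp: two_sided_ideal_def)

lemma relI_scale: "x \<in> relI \<Longrightarrow> r *\<^sub>R x \<in> relI"
  using relI_left[of x "r *\<^sub>R 1"] by simp

lemma relI_minus: "x \<in> relI \<Longrightarrow> - x \<in> relI"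
  using relI_left[of x "- 1"] by simp

lemma relI_diff: "x \<in> relI \<Longrightarrow> y \<in> relI \<Longrightarrow> x - y \<in> relI"
  using relI_add[of x "- y"] relI_minus[of y] by simp

lemma relI_induct [consumes 1, case_names gen zero add left right]:
  assumes "x \<in> relI" "\<And>k. P ((deltaT ^^ k) (cT 0 ^ 2))" "P 0"
    "\<And>x y. x \<in> relI \<Longrightarrow> y \<in> relI \<Longrightarrow> P x \<Longrightarrow> P y \<Longrightarrow> P (x + y)"
    "\<And>a x. x \<in> relI \<Longrightarrow> P x \<Longrightarrow> P (a * x)" "\<And>a x. x \<in> relI \<Longrightarrow> P x \<Longrightarrow> P (x * a)"
  shows "P x"
proof -
  have "two_sided_ideal hull {(deltaT ^^ k) (cT 0 ^ 2) |k. True} \<subseteq> {x \<in> relI. P x}"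
    by (rule hull_minimal)
       (auto simp: two_sided_ideal_def relI_0 relI_gen relI_add relI_left relI_right intro: assms)
  then show ?thesis using assms(1) unfolding relI_def by blast
qed

lemma parity_relI: "x \<in> relI \<Longrightarrow> parity x \<in> relI"
proof (induction rule: relI_induct)
  case (gen k)
  have "parity ((deltaT ^^ k) (cT 0 ^ 2)) = (deltaT ^^ k) (cT 0 ^ 2)"
    by (induction k) (simp_all add: parity_deltaT power2_eq_square)
  then show ?case by (simp add: relI_gen)
qed (auto intro: relI_0 relI_add relI_left relI_right)

lemma dT_relI: "x \<in> relI \<Longrightarrow> dT x \<in> relI"
proof (induction rule: relI_induct)
  case (gen k)
  have "dT ((deltaT ^^ k) (cT 0 ^ 2)) = 0"
    by (induction k) (simp_all add: dT_times power2_eq_square flip: deltaT_dT)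
  then show ?case by (simp add: relI_0)
qed (auto simp: dT_times intro: relI_0 relI_add relI_left relI_right parity_relI)

lemma deltaT_relI: "x \<in> relI \<Longrightarrow> deltaT x \<in> relI"
proof (induction rule: relI_induct)
  case (gen k)
  then show ?case using relI_gen[of "Suc k"] by simp
qed (auto simp: deltaT_times intro: relI_0 relI_add relI_left relI_right)

lemma eulerT_gen_power: "eulerT ((deltaT ^^ k) (cT 0 ^ 2)) = real k *\<^sub>R (deltaT ^^ k) (cT 0 ^ 2)"
  by (induction k)
     (simp_all add: eulerT_deltaT eulerT_times eulerT_gen power2_eq_square algebra_simps)

lemma sigmaT_relI: "x \<in> relI \<Longrightarrow> sigmaT x \<in> relI"
proof (induction rule: relI_induct)
  case (gen k)
  show ?case
  proof (induction k)
    case 0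
    then show ?case by (simp add: sigmaT_times sigmaT_gen power2_eq_square relI_0)
  next
    case (Suc k)
    then show ?case
      by (auto simp: sigmaT_deltaT eulerT_gen_power
          intro!: relI_add relI_scale deltaT_relI relI_gen)
  qed
qed (auto simp: sigmaT_times intro: relI_0 relI_add relI_left relI_right)

lemma coeff_unit_times:
  "coeff (x * y) ({||}, {#}) = coeff x ({||}, {#}) * coeff y ({||}, {#})"
proof (induction x rule: basis_induct)
  case (basis p)
  show ?case
    by (induction y rule: basis_induct)
       (auto simp: basis_times mono_mult_def ring_distribs prod_eq_iff)
qed (simp_all add: ring_distribs)

lemma one_notin_relI: "1 \<notin> relI"
proof -
  have "coeff (deltaT x) ({||}, {#}) = 0" for x
    by (induction x rule: wtilde_induct)
       (simp_all add: deltaT_times coeff_unit_times, simp_all add: hT_def cT_def prod_eq_iff fset_eq_iff)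
  moreover have "coeff (cT 0 ^ 2) ({||}, {#}) = 0"
    by (simp add: power2_eq_square coeff_unit_times cT_def)
  ultimately have gen: "coeff ((deltaT ^^ k) (cT 0 ^ 2)) ({||}, {#}) = 0" for k
    by (cases k) simp_all
  have "coeff x ({||}, {#}) = 0" if "x \<in> relI" for x
    using that by (induction rule: relI_induct) (simp_all add: gen coeff_unit_times)
  then show ?thesis by (force simp: one_wtilde_def)
qed

quotient_type dinfw = wtilde / "\<lambda>x y. x - y \<in> relI"
proof (rule equivpI)
  show "reflp (\<lambda>x y. x - y \<in> relI)" by (simp add: reflp_def relI_0)
  show "symp (\<lambda>x y. x - y \<in> relI)"
    by (rule sympI) (metis minus_diff_eq relI_minus)
  show "transp (\<lambda>x y. x - y \<in> relI)"
  proof (rule transpI)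
    fix x y z assume "x - y \<in> relI" "y - z \<in> relI"
    then show "x - z \<in> relI" using relI_add[of "x - y" "y - z"] by simp
  qed
qed

instantiation dinfw :: real_algebra_1
begin

lift_definition zero_dinfw :: dinfw is 0 .
lift_definition one_dinfw :: dinfw is 1 .

lift_definition plus_dinfw :: "dinfw \<Rightarrow> dinfw \<Rightarrow> dinfw" is "(+)"
  by (simp add: add_diff_add relI_add)

lift_definition minus_dinfw :: "dinfw \<Rightarrow> dinfw \<Rightarrow> dinfw" is "(-)"
  subgoal for x x' y y'
    using relI_diff[of "x - x'" "y - y'"] by (simp add: algebra_simps)
  done

lift_definition uminus_dinfw :: "dinfw \<Rightarrow> dinfw" is uminus
  by (simp only: minus_diff_minus relI_minus)

lift_definition scaleR_dinfw :: "real \<Rightarrow> dinfw \<Rightarrow> dinfw" is scaleR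
  by (simp only: relI_scale flip: scaleR_right_diff_distrib)

lift_definition times_dinfw :: "dinfw \<Rightarrow> dinfw \<Rightarrow> dinfw" is "(*)"
proof -
  fix x x' y y'
  assume "x - x' \<in> relI" "y - y' \<in> relI"
  then have "x * (y - y') + (x - x') * y' \<in> relI"
    by (intro relI_add relI_left relI_right)
  then show "x * y - x' * y' \<in> relI"
    by (simp add: algebra_simps)
qed

instance
proof
  show "(0::dinfw) \<noteq> 1"
    by transfer (use one_notin_relI relI_minus[of "- 1"] in auto)
qed (transfer; simp add: algebra_simps relI_0)+

end

definition proj :: "wtilde \<Rightarrow> dinfw" where
  "proj = abs_dinfw"

lift_definition dW :: "dinfw \<Rightarrow> dinfw" is dT
  by (simp only: dT_relI flip: linear_diff[OF linear_T(1)])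

lift_definition deltaW :: "dinfw \<Rightarrow> dinfw" is deltaT
  by (simp only: deltaT_relI flip: linear_diff[OF linear_T(2)])

lift_definition sigmaW :: "dinfw \<Rightarrow> dinfw" is sigmaT
  by (simp only: sigmaT_relI flip: linear_diff[OF linear_T(3)])

definition hW :: "nat \<Rightarrow> dinfw" where
  "hW i = proj (hT i)"

definition cW :: "nat \<Rightarrow> dinfw" where
  "cW i = proj (cT i)"

definition ord_part_W :: "nat \<Rightarrow> dinfw set" where
  "ord_part_W n = proj ` ord_part_T n"

lemma dW_add: "dW (x + y) = dW x + dW y"
  and deltaW_add: "deltaW (x + y) = deltaW x + deltaW y"
  and sigmaW_add: "sigmaW (x + y) = sigmaW x + sigmaW y"
  by (transfer; simp add: relI_0)+

lemma dW_scaleR: "dW (r *\<^sub>R x) = r *\<^sub>R dW x"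
  and deltaW_scaleR: "deltaW (r *\<^sub>R x) = r *\<^sub>R deltaW x"
  and sigmaW_scaleR: "sigmaW (r *\<^sub>R x) = r *\<^sub>R sigmaW x"
  by (transfer; simp add: relI_0)+

lemma linear_W: "linear dW" "linear deltaW" "linear sigmaW"
  by (auto intro!: linearI simp: dW_add deltaW_add sigmaW_add dW_scaleR deltaW_scaleR sigmaW_scaleR)

lemma dW_dW: "dW (dW x) = 0"
  by transfer (simp add: dT_dT relI_0)

lemma unsigned_derivation_deltaW: "unsigned_derivation deltaW"
  unfolding unsigned_derivation_def
  by (intro conjI allI linear_W; transfer) (simp add: deltaT_times relI_0)

lemma unsigned_derivation_sigmaW: "unsigned_derivation sigmaW"
  unfolding unsigned_derivation_def
  by (intro conjI allI linear_W; transfer) (simp add: sigmaT_times relI_0)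

lemma deltaW_dW: "deltaW (dW x) = dW (deltaW x)"
  by transfer (simp add: deltaT_dT relI_0)

lemma sigmaW_dW: "sigmaW (dW x) = dW (sigmaW x)"
  by transfer (simp add: sigmaT_dT relI_0)


section \<open>Cohomology\<close>

lemma subspace_range_dW: "subspace (range dW)"
  by (rule linear_subspace_image[OF linear_W(1) subspace_UNIV])

lemmas range_dW = subspace_0[OF subspace_range_dW] subspace_add[OF subspace_range_dW]
  subspace_diff[OF subspace_range_dW] subspace_scale[OF subspace_range_dW]
  subspace_neg[OF subspace_range_dW]

quotient_type cohom = dinfw / partial: "\<lambda>x y. dW x = 0 \<and> dW y = 0 \<and> x - y \<in> range dW"
proof (rule part_equivpI)
  show "\<exists>x. dW x = 0 \<and> dW x = 0 \<and> x - x \<in> range dW"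
    by (rule exI[of _ 0]) (simp add: linear_0[OF linear_W(1)] range_dW(1))
  show "symp (\<lambda>x y. dW x = 0 \<and> dW y = 0 \<and> x - y \<in> range dW)"
  proof (rule sympI, elim conjE, intro conjI)
    fix x y assume "x - y \<in> range dW"
    then show "y - x \<in> range dW" using range_dW(5)[of "x - y"] by simp
  qed
  show "transp (\<lambda>x y. dW x = 0 \<and> dW y = 0 \<and> x - y \<in> range dW)"
  proof (rule transpI, elim conjE, intro conjI)
    fix x y z assume "x - y \<in> range dW" "y - z \<in> range dW"
    then show "x - z \<in> range dW" using range_dW(2)[of "x - y" "y - z"] by simp
  qed
qed

lemmas dW_simps [simp] = linear_W(1)[THEN linear_0] linear_W(1)[THEN linear_add]
  linear_W(1)[THEN linear_diff] linear_W(1)[THEN linear_cmul] linear_W(1)[THEN linear_neg]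

instantiation cohom :: real_vector
begin

lift_definition zero_cohom :: cohom is 0
  by (simp add: range_dW)

lift_definition plus_cohom :: "cohom \<Rightarrow> cohom \<Rightarrow> cohom" is "(+)"
  by (simp add: add_diff_add range_dW)

lift_definition uminus_cohom :: "cohom \<Rightarrow> cohom" is uminus
  subgoal for x y
    using range_dW(5)[of "x - y"] by (simp only: minus_diff_minus linear_neg[OF linear_W(1)] minus_zero)
  done

lift_definition minus_cohom :: "cohom \<Rightarrow> cohom \<Rightarrow> cohom" is "(-)"
  subgoal for x x' y y'
    using range_dW(3)[of "x - x'" "y - y'"] by (simp add: algebra_simps)
  done

lift_definition scaleR_cohom :: "real \<Rightarrow> cohom \<Rightarrow> cohom" is scaleR
  by (simp add: range_dW flip: scaleR_right_diff_distrib)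

instance
  by standard (transfer; simp add: algebra_simps range_dW)+

end

text \<open>The class of a cocycle; the value is meaningful only if \<open>dW x = 0\<close>.\<close>

definition cohom_class :: "dinfw \<Rightarrow> cohom" where
  "cohom_class x = abs_cohom x"

lift_definition deltaH :: "cohom \<Rightarrow> cohom" is deltaW
  subgoal for x y
    using linear_diff[OF linear_W(2), of x y] linear_0[OF linear_W(2)]
    by (auto simp flip: deltaW_dW) (metis deltaW_dW rangeI)
  done

lift_definition sigmaH :: "cohom \<Rightarrow> cohom" is sigmaW
  subgoal for x y
    using linear_diff[OF linear_W(3), of x y] linear_0[OF linear_W(3)]
    by (auto simp flip: sigmaW_dW) (metis sigmaW_dW rangeI)
  done

definition ord_part_H :: "nat \<Rightarrow> cohom set" where
  "ord_part_H n = {cohom_class x |x. dW x = 0 \<and> x \<in> ord_part_W n}"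

definition F_eig :: "real \<Rightarrow> nat \<Rightarrow> cohom set" where
  "F_eig \<mu> n = {a \<in> ord_part_H n. (deltaH \<circ> sigmaH) a = \<mu> *\<^sub>R a}"

lemma cohom_class_eq_iff:
  assumes "dW x = 0" "dW y = 0"
  shows "cohom_class x = cohom_class y \<longleftrightarrow> x - y \<in> range dW"
  using assms Quotient_rel[OF Quotient_cohom, of x y] by (simp add: cohom_class_def range_dW)

lemma deltaH_class: "dW x = 0 \<Longrightarrow> deltaH (cohom_class x) = cohom_class (deltaW x)"
  by (simp add: cohom_class_def deltaH.abs_eq eq_onp_def range_dW)

lemma sigmaH_class: "dW x = 0 \<Longrightarrow> sigmaH (cohom_class x) = cohom_class (sigmaW x)"
  by (simp add: cohom_class_def sigmaH.abs_eq eq_onp_def range_dW)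

end

theory Submission
  imports Defs
begin

text \<open>
  Closedness and the vanishing of \<open>\<sigma>\<close> on the cochain follow from the relations of orders \<open>0\<close> to
  \<open>3\<close>. For non-triviality, note that \<open>d\<close> preserves the order and the total number of factors; a
  primitive would have four factors \<open>h\<close> and hence order at least \<open>0 + 1 + 2 + 3 > 5\<close>. So the class
  vanishes only if the cochain lies in the ideal, and this is excluded because the only quadratic
  relation of order \<open>2\<close> is \<open>c\<^sub>(\<^sub>0\<^sub>)c\<^sub>(\<^sub>2\<^sub>) + c\<^sub>(\<^sub>1\<^sub>)\<^sup>2\<close>.
\<close>

lemma coeff_hT_times:
  "coeff (hT i * x) (A, m) =
     (if i |\<in>| A then shuffle_sign {i} (fset A - {i}) * coeff x (A |-| {|i|}, m) else 0)"
proof (induction x rule: basis_induct)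
  case (basis p)
  obtain B n where p: "p = (B, n)" by force
  show ?case
  proof (cases "i |\<in>| B")
    case True
    then have "shuffle_sign {i} (fset B) = 0"
      by (intro sign_eq_0) auto
    moreover have "A |-| {|i|} \<noteq> B" using True by auto
    ultimately show ?thesis by (simp add: p hT_def basis_times')
  next
    case False
    then have "A = finsert i B \<longleftrightarrow> i |\<in>| A \<and> A |-| {|i|} = B" by auto
    then show ?thesis
      using False by (auto simp: p hT_def basis_times')
  qed
qed (auto simp: algebra_simps)

lemma coeff_cT_times:
  "coeff (cT i * x) (A, m) = (if i \<in># m then coeff x (A, m - {#i#}) else 0)"
proof (induction x rule: basis_induct)
  case (basis p)
  obtain B n where p: "p = (B, n)" by force
  show ?case
    by (auto simp: p cT_def basis_times')
qed (auto simp: algebra_simps)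

lemma coeff_parity: "coeff (parity x) p = (-1) ^ mono_deg p * coeff x p"
  by (induction x rule: basis_induct) (auto simp: algebra_simps)

text \<open>Linear conditions satisfied on the ideal but violated by the cochain, even modulo exact
  terms. Fixing the exterior part \<open>A\<close> makes them stable under multiplication by the odd
  generators.\<close>

definition relI_coeffs :: "wtilde \<Rightarrow> bool" where
  "relI_coeffs x \<longleftrightarrow> (\<forall>A m. size m < 2 \<longrightarrow> coeff x (A, m) = 0) \<and>
     (\<forall>A. coeff x (A, {#0, 2#}) = coeff x (A, {#1, 1#}))"

lemma relI_coeffs_0: "relI_coeffs 0"
  and relI_coeffs_add: "relI_coeffs x \<Longrightarrow> relI_coeffs y \<Longrightarrow> relI_coeffs (x + y)"
  and relI_coeffs_scale: "relI_coeffs x \<Longrightarrow> relI_coeffs (r *\<^sub>R x)"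
  by (simp_all add: relI_coeffs_def)

text \<open>A factor \<open>hT i\<close> and \<open>parity\<close> change only \<open>A\<close> and
  a sign depending on \<open>A\<close> alone, the same for both quadratic monomials. A factor
  \<open>cT i\<close> adds an even generator, so nothing with at most two of them survives.\<close>

lemma relI_coeffs_gen_times:
  assumes "relI_coeffs x"
  shows "relI_coeffs (hT i * x)" "relI_coeffs (cT i * x)" "relI_coeffs (parity x)"
proof -
  show "relI_coeffs (hT i * x)" "relI_coeffs (parity x)"
    using assms by (auto simp: relI_coeffs_def coeff_hT_times coeff_parity mono_deg_def)
  have "coeff (cT i * x) (A, m) = 0" if "size m \<le> 2" for A m
    using assms that by (auto simp: relI_coeffs_def coeff_cT_times size_Diff_singleton_if)
  then show "relI_coeffs (cT i * x)"
    by (simp add: relI_coeffs_def)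
qed

text \<open>Right multiplication by \<open>hT i\<close> is left multiplication after
  \<open>parity\<close>, hence the closure under \<open>parity\<close> above.\<close>

lemma relI_coeffs_times: "relI_coeffs x \<Longrightarrow> relI_coeffs (a * x) \<and> relI_coeffs (x * a)"
proof (induction a arbitrary: x rule: wtilde_induct)
  case (times a b)
  then show ?case by (simp add: mult.assoc) (simp flip: mult.assoc)
qed (simp_all add: times_h times_c ring_distribs relI_coeffs_gen_times relI_coeffs_add relI_coeffs_scale)

text \<open>By the Leibniz rule each application of \<open>deltaT\<close> raises one index by
  one.\<close>

lemma deltaT_power_span:
  "(deltaT ^^ k) (cT 0 ^ 2) \<in> span {cT i * cT j |i j. i + j = k}"
proof (induction k)
  case 0
  show ?case by (auto simp: power2_eq_square intro: span_base)
next
  case (Suc k)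
  have "deltaT x \<in> span {cT i * cT j |i j. i + j = Suc k}"
    if "x \<in> span {cT i * cT j |i j. i + j = k}" for x
    using that
  proof (induction rule: span_induct_alt)
    case (step r x y)
    then obtain i j where ij: "x = cT i * cT j" "i + j = k" by auto
    have "cT (i + 1) * cT j \<in> span {cT i * cT j |i j. i + j = Suc k}"
      "cT i * cT (j + 1) \<in> span {cT i * cT j |i j. i + j = Suc k}"
      using ij by (intro span_base; force)+
    then have "deltaT x \<in> span {cT i * cT j |i j. i + j = Suc k}"
      unfolding ij deltaT_times deltaT_gen by (rule span_add)
    then show ?case using step by (simp add: span_add span_scale)
  qed (simp add: span_zero)
  then show ?case using Suc by simp
qed

lemma deltaT_power_small:
  "(deltaT ^^ 1) (cT 0 ^ 2) = 2 *\<^sub>R (cT 0 * cT 1)"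
  "(deltaT ^^ 2) (cT 0 ^ 2) = 2 *\<^sub>R (cT 0 * cT 2 + cT 1 * cT 1)"
  "(deltaT ^^ 3) (cT 0 ^ 2) = 2 *\<^sub>R (cT 0 * cT 3 + 3 *\<^sub>R (cT 1 * cT 2))"
  by (simp_all add: eval_nat_numeral deltaT_times times_c[of "cT (Suc _)" 0]
      times_c[of "cT (Suc (Suc 0))" "Suc 0"] scaleR_add_left scaleR_add_right
      flip: scaleR_2)
    (simp flip: scaleR_add_left)

lemma mset_pair_eq_iff: "{#a, b#} = {#c, d#} \<longleftrightarrow> a = c \<and> b = d \<or> a = d \<and> b = c"
  by (auto simp: add_eq_conv_diff)

lemma coeff_cT_cT: "coeff (cT i * cT j) (A, m) = (if A = {||} \<and> m = {#i, j#} then 1 else 0)"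
  by (auto simp: cT_def basis_times')

text \<open>Both monomials being compared have index sum 2, so they occur only for
  \<open>k = 2\<close>, where the explicit formula gives each the coefficient 2.\<close>

lemma relI_coeffs_deltaT_power: "relI_coeffs ((deltaT ^^ k) (cT 0 ^ 2))"
proof (cases "k = 2")
  case True
  show ?thesis
    unfolding True deltaT_power_small
    by (auto simp: relI_coeffs_def coeff_cT_cT mset_pair_eq_iff)
next
  case False
  show ?thesis
    using deltaT_power_span
  proof (induction rule: span_induct_alt)
    case (step r x y)
    then show ?case
      using False by (auto simp: relI_coeffs_def coeff_cT_cT mset_pair_eq_iff split: if_splits)
  qed (rule relI_coeffs_0)
qed

lemma relI_coeffs: "x \<in> relI \<Longrightarrow> relI_coeffs x"
proof (induction rule: relI_induct)
  case (gen k)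
  show ?case by (rule relI_coeffs_deltaT_power)
qed (simp_all add: relI_coeffs_times relI_coeffs_0 relI_coeffs_add)

text \<open>The differential trades a factor \<open>hT a\<close> for \<open>cT a\<close>, and the
  squarefree exterior part then no longer contains \<open>a\<close>.\<close>

lemma coeff_dT_eq_0:
  assumes "\<And>a. a \<in># m \<Longrightarrow> a |\<in>| A"
  shows "coeff (dT x) (A, m) = 0"
proof (induction x rule: basis_induct)
  case (basis p)
  obtain B n where p: "p = (B, n)" by force
  have "coeff (cT a * diff_h a (basis_elt p)) (A, m) = 0" for a
    using assms by (auto simp: p coeff_cT_times diff_h_basis)
  then show ?case by (simp add: dT_def der_def coeff_sum)
qed simp_all

lemma relI_basis_mono:
  assumes "basis_elt ({||}, m) \<in> relI" "m \<subseteq># n"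
  shows "basis_elt (A, n) \<in> relI"
  using relI_left[OF assms(1), of "basis_elt (A, n - m)"] assms(2) by (simp add: basis_times')

text \<open>For the third monomial, \<open>cT 2\<close> times the order 2 relation reduces it to
  \<open>{#1, 1, 2#}\<close>. That one lies in the ideal by \<open>cT 1\<close> times the order 3
  relation, whose other term is divisible by \<open>cT 0 * cT 1\<close>.\<close>

lemma relI_basis:
  "basis_elt ({||}, {#0, 0#}) \<in> relI"
  "basis_elt ({||}, {#0, 1#}) \<in> relI"
  "basis_elt ({||}, {#0, 2, 2#}) \<in> relI"
proof -
  note gen = relI_gen[of 0, simplified] relI_gen[of 1] relI_gen[of 2] relI_gen[of 3]
  have half: "y \<in> relI" if "2 *\<^sub>R y \<in> relI" for y
    using relI_scale[OF that, of "1 / 2"] by simp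
  note c = cT_def basis_times'
  show r00: "basis_elt ({||}, {#0, 0#}) \<in> relI"
    using gen(1) by (simp add: power2_eq_square c)
  show r01: "basis_elt ({||}, {#0, 1#}) \<in> relI"
    using half[OF gen(2)[unfolded deltaT_power_small]] by (simp add: c add_mset_commute)
  have r2: "basis_elt ({||}, {#0, 2#}) + basis_elt ({||}, {#1, 1#}) \<in> relI"
    using half[OF gen(3)[unfolded deltaT_power_small]] by (simp add: c add_mset_commute)
  have r3: "basis_elt ({||}, {#0, 3#}) + 3 *\<^sub>R basis_elt ({||}, {#1, 2#}) \<in> relI"
    using half[OF gen(4)[unfolded deltaT_power_small]] by (simp add: c add_mset_commute)
  let ?b = "\<lambda>m. basis_elt ({||}, m)"
  have "?b {#0, 1, 3#} + 3 *\<^sub>R ?b {#1, 1, 2#} \<in> relI"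
    using relI_left[OF r3, of "cT 1"] by (simp add: c ring_distribs add_mset_commute)
  moreover have "?b {#0, 1, 3#} \<in> relI"
    by (rule relI_basis_mono[OF r01]) simp
  ultimately have "3 *\<^sub>R ?b {#1, 1, 2#} \<in> relI"
    using relI_diff by fastforce
  then have r112: "?b {#1, 1, 2#} \<in> relI"
    using relI_scale[of _ "1 / 3"] by fastforce
  have "?b {#0, 2, 2#} + ?b {#1, 1, 2#} \<in> relI"
    using relI_left[OF r2, of "cT 2"] by (simp add: c ring_distribs add_mset_commute)
  then show "?b {#0, 2, 2#} \<in> relI"
    using relI_diff[OF _ r112] by fastforce
qed

lemma hhhcc_basis: "hT 0 * hT 1 * hT 2 * cT 0 * cT 2 = basis_elt ({|0, 1, 2|}, {#0, 2#})"
  by (simp add: hT_def cT_def basis_times' shuffle_sign_def add_mset_commute finsert_commute)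

lemma dT_hhhcc: "dT (hT 0 * hT 1 * hT 2 * cT 0 * cT 2) \<in> relI"
proof -
  have "dT (hT 0 * hT 1 * hT 2 * cT 0 * cT 2) =
      basis_elt ({|1, 2|}, {#0, 0, 2#}) - basis_elt ({|0, 2|}, {#0, 1, 2#}) +
      basis_elt ({|0, 1|}, {#0, 2, 2#})"
    by (simp add: dT_times ring_distribs)
       (simp add: hT_def cT_def basis_times' shuffle_sign_def add_mset_commute finsert_commute)
  \<comment> \<open>The terms come from differentiating \<open>hT 0\<close>, \<open>hT 1\<close> and
    \<open>hT 2\<close>; each contains one of the three monomials of
    \<open>relI_basis\<close>.\<close>
  also have "\<dots> \<in> relI"
    by (intro relI_add relI_diff relI_basis_mono[OF relI_basis(1)]
        relI_basis_mono[OF relI_basis(2)] relI_basis_mono[OF relI_basis(3)])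
       (simp_all add: add_mset_commute)
  finally show ?thesis .
qed

lemma sigmaT_hhhcc: "sigmaT (hT 0 * hT 1 * hT 2 * cT 0 * cT 2) \<in> relI"
proof -
  \<comment> \<open>The factor \<open>i * (i - 1) / 2\<close> is 0 for indices 0 and 1, and lowering
    \<open>hT 2\<close> repeats \<open>hT 1\<close>; only lowering \<open>cT 2\<close>
    contributes.\<close>
  have "sigmaT (hT 0 * hT 1 * hT 2 * cT 0 * cT 2) = basis_elt ({|0, 1, 2|}, {#0, 1#})"
    by (simp add: sigmaT_times sigmaT_gen)
       (simp add: hT_def cT_def basis_times' shuffle_sign_def add_mset_commute finsert_commute)
  also have "\<dots> \<in> relI" by (rule relI_basis_mono[OF relI_basis(2)]) simp
  finally show ?thesis .
qed

lemma hhhcc_not_exact: "hT 0 * hT 1 * hT 2 * cT 0 * cT 2 - dT y \<notin> relI"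
proof
  assume "hT 0 * hT 1 * hT 2 * cT 0 * cT 2 - dT y \<in> relI"
  then have *: "relI_coeffs (basis_elt ({|0, 1, 2|}, {#0, 2#}) - dT y)"
    unfolding hhhcc_basis by (rule relI_coeffs)
  \<comment> \<open>All even indices here lie in the exterior part, so exact terms contribute
    nothing; the cochain alone has coefficients 1 and 0, which \<open>relI_coeffs\<close> would
    force to agree.\<close>
  moreover have "coeff (dT y) ({|0, 1, 2|}, {#0, 2#}) = 0" "coeff (dT y) ({|0, 1, 2|}, {#1, 1#}) = 0"
    by (rule coeff_dT_eq_0; auto)+
  ultimately show False
    by (auto simp: relI_coeffs_def mset_pair_eq_iff dest!: spec[of _ "{|0, 1, 2|}"])
qed

lemma proj_eq_0_iff: "proj x = 0 \<longleftrightarrow> x \<in> relI"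
  by (simp add: proj_def zero_dinfw.abs_eq dinfw.abs_eq_iff)

lemma proj_mult: "proj (x * y) = proj x * proj y"
  and proj_diff: "proj (x - y) = proj x - proj y"
  and dW_proj: "dW (proj x) = proj (dT x)"
  and sigmaW_proj: "sigmaW (proj x) = proj (sigmaT x)"
  by (simp_all add: proj_def times_dinfw.abs_eq minus_dinfw.abs_eq dW.abs_eq sigmaW.abs_eq)

lemma proj_surj: obtains x where "y = proj x"
  unfolding proj_def by (metis Quotient_dinfw Quotient_abs_rep)

theorem proposition10p11:
  shows "let x = hW 0 * hW 1 * hW 2 * cW 0 * cW 2 in
    dW x = 0 \<and> cohom_class x \<in> F_eig 0 5 \<and> cohom_class x \<noteq> 0"
proof -
  define x where "x = hW 0 * hW 1 * hW 2 * cW 0 * cW 2"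
  have x: "x = proj (hT 0 * hT 1 * hT 2 * cT 0 * cT 2)"
    by (simp add: x_def hW_def cW_def proj_mult)
  have zero: "cohom_class 0 = 0"
    by (simp add: cohom_class_def zero_cohom_def)
  have closed: "dW x = 0"
    using dT_hhhcc by (simp add: x dW_proj proj_eq_0_iff)
  have "sigmaW x = 0"
    using sigmaT_hhhcc by (simp add: x sigmaW_proj proj_eq_0_iff)
  then have "(deltaH \<circ> sigmaH) (cohom_class x) = 0"
    using closed deltaH_class[of 0] linear_0[OF linear_W(2)] zero by (simp add: sigmaH_class)
  moreover have "basis_elt ({|0, 1, 2|}, {#0, 2#}) \<in> ord_part_T 5"
    by (auto simp: ord_part_T_def mono_ord_def)
  then have "x \<in> ord_part_W 5"
    unfolding x hhhcc_basis ord_part_W_def by (rule imageI)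
  then have "cohom_class x \<in> ord_part_H 5"
    using closed by (auto simp: ord_part_H_def)
  ultimately have "cohom_class x \<in> F_eig 0 5"
    by (simp add: F_eig_def)
  moreover have "cohom_class x \<noteq> 0"
  proof
    assume "cohom_class x = 0"
    then have "x \<in> range dW"
      using cohom_class_eq_iff[of x 0] closed zero by simp
    then obtain y where "x = dW y" by auto
    \<comment> \<open>Lifting the primitive turns exactness in the quotient into membership in
      \<open>relI\<close>.\<close>
    moreover obtain z where "y = proj z" by (rule proj_surj)
    ultimately have "proj (hT 0 * hT 1 * hT 2 * cT 0 * cT 2 - dT z) = 0"
      by (simp add: x dW_proj proj_diff)
    then show False
      using hhhcc_not_exact by (simp add: proj_eq_0_iff)
  qed
  ultimately show ?thesis
    using closed by (simp add: x_def Let_def)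
qed

end
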